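(* Let $\Gamma\le\mathcal{S}_n$ be a transitive $2$-homogeneous permutation group. Then the number of core points with respect to $\Gamma$ up to translation by $\mathbb{1}$ is finite; that is, the set of core points of $\Gamma$ modulo the equivalence relation $z\sim z'\iff z-z'\in\mathbb{Z}\,\mathbb{1}$ is finite.
   Context: $\mathcal{S}_n$ is the symmetric group on $[n]=\{1,\dots,n\}$; a subgroup $\Gamma\le\mathcal{S}_n$ acts on $\mathbb{R}^n$ by permuting coordinates. $\mathbb{1}$ is the all-ones vector. $\Gamma$ is $2$-homogeneous if for every two $2$-element subsets $X,Y\subseteq[n]$ there is $\gamma\in\Gamma$ with $\gamma X=Y$. A point $z\in\mathbb{Z}^n$ is a core point with respect to $\Gamma$ if $\operatorname{conv}(\Gamma z)\cap\mathbb{Z}^n=\Gamma z$. *)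

theory Defs
  imports "HOL-Analysis.Analysis" "HOL-Algebra.Group_Action"
begin

text \<open>The index type \<open>'n\<close> plays the role of \<open>{1, \<dots>, n}\<close>, and \<^term>\<open>BijGroup (UNIV :: 'n set)\<close>
  that of the symmetric group on it (extensionality is vacuous on \<^term>\<open>UNIV\<close>).\<close>

abbreviation perm_group :: "('n \<Rightarrow> 'n) set \<Rightarrow> ('n \<Rightarrow> 'n) monoid"
  where "perm_group \<Gamma> \<equiv> (BijGroup UNIV)\<lparr>carrier := \<Gamma>\<rparr>"

definition two_homogeneous :: "('n \<Rightarrow> 'n) set \<Rightarrow> bool"
  where "two_homogeneous \<Gamma> \<longleftrightarrow>
    (\<forall>X Y. card X = 2 \<longrightarrow> card Y = 2 \<longrightarrow> (\<exists>\<gamma>\<in>\<Gamma>. \<gamma> ` X = Y))"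

text \<open>The inverse makes this a left action: \<open>\<gamma>\<close> sends the \<open>i\<close>-th unit vector to the \<open>\<gamma> i\<close>-th one.\<close>

definition permute_coords :: "('n \<Rightarrow> 'n) \<Rightarrow> real ^ 'n \<Rightarrow> real ^ 'n"
  where "permute_coords \<gamma> x = (\<chi> i. x $ inv_into UNIV \<gamma> i)"

definition int_points :: "(real ^ 'n) set"
  where "int_points = {z. \<forall>i. z $ i \<in> \<int>}"

definition core_point :: "('n::finite \<Rightarrow> 'n) set \<Rightarrow> real ^ 'n \<Rightarrow> bool"
  where "core_point \<Gamma> z \<longleftrightarrow> z \<in> int_points \<and>
    convex hull (orbit (perm_group \<Gamma>) permute_coords z) \<inter> int_points
      = orbit (perm_group \<Gamma>) permute_coords z"

definition core_points :: "('n::finite \<Rightarrow> 'n) set \<Rightarrow> (real ^ 'n) set"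
  where "core_points \<Gamma> = {z. core_point \<Gamma> z}"

text \<open>Below, \<^term>\<open>1 :: real ^ 'n\<close> is the all-ones vector.\<close>

definition translation_rel :: "('n::finite \<Rightarrow> 'n) set \<Rightarrow> ((real ^ 'n) \<times> (real ^ 'n)) set"
  where "translation_rel \<Gamma> = {(z, z'). z \<in> core_points \<Gamma> \<and> z' \<in> core_points \<Gamma> \<and>
    (\<exists>k::int. z - z' = of_int k *\<^sub>R 1)}"

lemma equiv_translation_rel: "equiv (core_points \<Gamma>) (translation_rel \<Gamma>)"
proof (rule equivI)
  show "translation_rel \<Gamma> \<subseteq> core_points \<Gamma> \<times> core_points \<Gamma>"
    by (auto simp: translation_rel_def)
  show "refl_on (core_points \<Gamma>) (translation_rel \<Gamma>)"
  proof (rule refl_onI)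
    fix z assume "z \<in> core_points \<Gamma>"
    moreover have "z - z = of_int 0 *\<^sub>R 1" by simp
    ultimately show "(z, z) \<in> translation_rel \<Gamma>"
      unfolding translation_rel_def by blast
  qed
  show "sym (translation_rel \<Gamma>)"
  proof (rule symI)
    fix z z' assume "(z, z') \<in> translation_rel \<Gamma>"
    then obtain k :: int where "z \<in> core_points \<Gamma>" "z' \<in> core_points \<Gamma>"
        "z - z' = of_int k *\<^sub>R 1"
      by (auto simp: translation_rel_def)
    moreover have "z' - z = of_int (- k) *\<^sub>R 1"
      using arg_cong[OF \<open>z - z' = _\<close>, of uminus] by simp
    ultimately show "(z', z) \<in> translation_rel \<Gamma>"
      unfolding translation_rel_def by blast
  qed
  show "trans (translation_rel \<Gamma>)"
  proof (rule transI)
    fix x y z assume "(x, y) \<in> translation_rel \<Gamma>" "(y, z) \<in> translation_rel \<Gamma>"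
    then obtain k l :: int where "x \<in> core_points \<Gamma>" "z \<in> core_points \<Gamma>"
        "x - y = of_int k *\<^sub>R 1" "y - z = of_int l *\<^sub>R 1"
      by (auto simp: translation_rel_def)
    moreover have "x - z = of_int (k + l) *\<^sub>R 1"
      using arg_cong2[OF \<open>x - y = _\<close> \<open>y - z = _\<close>, of "(+)"] by (simp add: scaleR_add_left)
    ultimately show "(x, z) \<in> translation_rel \<Gamma>"
      unfolding translation_rel_def by blast
  qed
qed

end

theory Submission
  imports Defs
begin

text \<open>
  Write \<open>w\<close> for the projection of \<open>z\<close> to the hyperplane of vectors with coordinate sum \<open>0\<close>.
  The matrix \<open>\<Sum>\<^sub>\<gamma> (\<gamma> w) (\<gamma> w)\<^sup>T\<close> is \<open>\<Gamma>\<close>-invariant, so transitivity and 2-homogeneity force it to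
  have the form \<open>a I + o J\<close>, where \<open>J\<close> is the all-ones matrix. Hence the numbers \<open>\<langle>\<gamma> w, u\<rangle>\<close> have
  mean \<open>0\<close> and mean square at least \<open>\<parallel>w\<parallel>\<^sup>2 \<parallel>u\<parallel>\<^sup>2 / n\<close> for every \<open>u\<close> in the hyperplane. Since they are
  bounded below by \<open>- \<parallel>w\<parallel> \<parallel>u\<parallel>\<close>, their maximum is at least \<open>\<parallel>w\<parallel> \<parallel>u\<parallel> / n\<close>: the orbit polytope of
  \<open>w\<close> contains the ball of radius \<open>\<parallel>w\<parallel> / n\<close>. If \<open>\<parallel>w\<parallel>\<close> is large, this ball contains an integer
  point closer to the centre than the orbit, so \<open>z\<close> is not a core point.
\<close>

section \<open>Invariance of sums over the group\<close>

locale transitive_two_homogeneous =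
  fixes \<Gamma> :: "('n::finite \<Rightarrow> 'n) set"
  assumes nonempty: "\<Gamma> \<noteq> {}"
    and bij: "\<gamma> \<in> \<Gamma> \<Longrightarrow> bij \<gamma>"
    and comp_closed: "\<gamma> \<in> \<Gamma> \<Longrightarrow> \<delta> \<in> \<Gamma> \<Longrightarrow> \<gamma> \<circ> \<delta> \<in> \<Gamma>"
    and transitive: "\<exists>\<gamma>\<in>\<Gamma>. \<gamma> i = j"
    and two_hom: "two_homogeneous \<Gamma>"
begin

lemma card_pos: "card \<Gamma> > 0"
  using nonempty by (simp add: card_gt_0_iff)

text \<open>Left multiplication by \<open>\<delta>\<close> is an injective self-map of the finite
  set \<open>\<Gamma>\<close>, hence a permutation of it; finiteness takes the place of
  inverses.\<close>

lemma sum_reindex_comp: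
  assumes "\<delta> \<in> \<Gamma>"
  shows "(\<Sum>\<gamma>\<in>\<Gamma>. h (\<delta> \<circ> \<gamma>)) = sum h \<Gamma>"
proof -
  have "inj_on ((\<circ>) \<delta>) \<Gamma>"
    using bij[OF assms] by (auto simp: inj_on_def fun_eq_iff bij_def dest: injD)
  then have "bij_betw ((\<circ>) \<delta>) \<Gamma> \<Gamma>"
    using comp_closed[OF assms] endo_inj_surj[of \<Gamma> "(\<circ>) \<delta>"]
    by (simp add: bij_betw_def image_subset_iff)
  then show ?thesis by (rule sum.reindex_bij_betw)
qed

lemma permute_comp_nth:
  assumes "\<delta> \<in> \<Gamma>" "\<gamma> \<in> \<Gamma>"
  shows "permute_coords (\<delta> \<circ> \<gamma>) w $ \<delta> k = permute_coords \<gamma> w $ k"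
  using assms by (simp add: permute_coords_def o_inv_distrib bij bij_is_inj)

lemma sum_permute_coords:
  assumes "\<gamma> \<in> \<Gamma>"
  shows "(\<Sum>k\<in>UNIV. h (permute_coords \<gamma> w $ k)) = (\<Sum>k\<in>UNIV. h (w $ k))"
  using sum.reindex_bij_betw[OF bij_imp_bij_inv[OF bij[OF assms]], of "\<lambda>k. h (w $ k)"]
  by (simp add: permute_coords_def)

lemma norm_permute_coords:
  "\<gamma> \<in> \<Gamma> \<Longrightarrow> norm (permute_coords \<gamma> w) = norm w"
  using sum_permute_coords[of \<gamma> "\<lambda>t. t\<^sup>2" w] by (simp add: norm_vec_def L2_set_def)

section \<open>The Gram matrix of an orbit\<close>

definition gram :: "real ^ 'n \<Rightarrow> 'n \<Rightarrow> 'n \<Rightarrow> real"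
  where "gram w k l = (\<Sum>\<gamma>\<in>\<Gamma>. permute_coords \<gamma> w $ k * permute_coords \<gamma> w $ l)"

lemma gram_commute: "gram w k l = gram w l k"
  by (simp add: gram_def mult.commute)

lemma gram_invariant:
  assumes "\<delta> \<in> \<Gamma>"
  shows "gram w (\<delta> k) (\<delta> l) = gram w k l"
  unfolding gram_def
  by (subst sum_reindex_comp[OF assms, symmetric])
     (simp add: permute_comp_nth[OF assms])

lemma gram_diagonal: "gram w k k = gram w l l"
  using transitive[of k l] gram_invariant[of _ w k k] by metis

text \<open>2-homogeneity moves only unordered pairs, so \<open>\<delta>\<close> may swap the two
  indices; symmetry of the matrix absorbs the swap.\<close>

lemma gram_off_diagonal:
  assumes "k \<noteq> l" "i \<noteq> j"
  shows "gram w k l = gram w i j"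
proof -
  obtain \<delta> where \<delta>: "\<delta> \<in> \<Gamma>" "\<delta> ` {k, l} = {i, j}"
    using two_hom assms unfolding two_homogeneous_def by (metis card_2_iff)
  then have "\<delta> k = i \<and> \<delta> l = j \<or> \<delta> k = j \<and> \<delta> l = i"
    by (auto simp: doubleton_eq_iff)
  then show ?thesis
    using gram_invariant[OF \<delta>(1), of w k l] gram_commute by metis
qed

text \<open>With diagonal entry \<open>d\<close> and off-diagonal entry \<open>b\<close>, only the
  term with factor \<open>d - b\<close> survives on the hyperplane. The trace gives the value of
  \<open>d\<close>, and the kernel vector \<open>1\<close> forces \<open>b \<le> 0\<close>, so
  \<open>d - b\<close> is at least \<open>d\<close>.\<close>

lemma sum_inner_squared:
  assumes w: "(\<Sum>k\<in>UNIV. w $ k) = 0" and u: "(\<Sum>k\<in>UNIV. u $ k) = 0"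
  shows "real CARD('n) * (\<Sum>\<gamma>\<in>\<Gamma>. (permute_coords \<gamma> w \<bullet> u)\<^sup>2)
    \<ge> real (card \<Gamma>) * (norm w)\<^sup>2 * (norm u)\<^sup>2"
proof -
  define n where "n = real CARD('n)"
  have n: "n \<ge> 1" unfolding n_def by (simp add: Suc_leI)
  obtain d where d: "\<And>k. gram w k k = d"
    using gram_diagonal by metis
  obtain b where b: "\<And>k l. k \<noteq> l \<Longrightarrow> gram w k l = b"
    using gram_off_diagonal by metis
  have gram: "gram w k l = b + (if k = l then d - b else 0)" for k l
    using d b by auto
  \<comment> \<open>Stated for every \<open>v\<close> because it is needed both at \<open>u\<close>
    and at the vector \<open>1\<close>.\<close>
  have form: "(\<Sum>\<gamma>\<in>\<Gamma>. (permute_coords \<gamma> w \<bullet> v)\<^sup>2)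
      = b * (\<Sum>k\<in>UNIV. v $ k)\<^sup>2 + (d - b) * (norm v)\<^sup>2" for v
  proof -
    have "(\<Sum>\<gamma>\<in>\<Gamma>. (permute_coords \<gamma> w \<bullet> v)\<^sup>2) = (\<Sum>\<gamma>\<in>\<Gamma>. \<Sum>k\<in>UNIV. \<Sum>l\<in>UNIV.
        (v $ k * v $ l) * (permute_coords \<gamma> w $ k * permute_coords \<gamma> w $ l))"
      by (simp add: inner_vec_def power2_eq_square sum_product mult_ac)
    also have "\<dots> = (\<Sum>k\<in>UNIV. \<Sum>l\<in>UNIV. (v $ k * v $ l) * gram w k l)"
      unfolding gram_def sum_distrib_left
      by (subst sum.swap, rule sum.cong[OF refl], rule sum.swap)
    also have "\<dots> = (\<Sum>k\<in>UNIV. \<Sum>l\<in>UNIV. b * (v $ k * v $ l))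
        + (\<Sum>k\<in>UNIV. \<Sum>l\<in>UNIV. if k = l then (d - b) * (v $ k * v $ l) else 0)"
      unfolding gram sum.distrib[symmetric] by (intro sum.cong) (auto simp: algebra_simps)
    also have "\<dots> = b * (\<Sum>k\<in>UNIV. v $ k)\<^sup>2 + (d - b) * (norm v)\<^sup>2"
    proof -
      have "(norm v)\<^sup>2 = (\<Sum>k\<in>UNIV. v $ k * v $ k)"
        by (simp add: power2_norm_eq_inner inner_vec_def)
      moreover have "(\<Sum>k\<in>UNIV. v $ k)\<^sup>2 = (\<Sum>k\<in>UNIV. \<Sum>l\<in>UNIV. v $ k * v $ l)"
        by (simp only: power2_eq_square sum_product)
      ultimately show ?thesis by (simp only: sum_distrib_left) simp
    qed
    finally show ?thesis .
  qed
  have trace: "n * d = real (card \<Gamma>) * (norm w)\<^sup>2"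
  proof -
    have "n * d = (\<Sum>k\<in>UNIV. gram w k k)" by (simp add: d n_def)
    also have "\<dots> = (\<Sum>\<gamma>\<in>\<Gamma>. (norm (permute_coords \<gamma> w))\<^sup>2)"
      unfolding gram_def power2_norm_eq_inner inner_vec_def by (subst sum.swap) simp
    finally show ?thesis by (simp add: norm_permute_coords)
  qed
  \<comment> \<open>The all-ones vector lies in the kernel of the Gram form.\<close>
  have "permute_coords \<gamma> w \<bullet> 1 = 0" if "\<gamma> \<in> \<Gamma>" for \<gamma>
    using sum_permute_coords[OF that, of "\<lambda>t. t" w] w by (simp add: inner_vec_def)
  then have "b * n\<^sup>2 + (d - b) * n = 0"
    using form[of 1] by (simp add: n_def power2_norm_eq_inner inner_vec_def)
  moreover have "b * n\<^sup>2 + (d - b) * n = n * (b * n + (d - b))"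
    by (simp add: algebra_simps power2_eq_square)
  ultimately have "n * (b * n + (d - b)) = 0" by simp
  then have "b * n + (d - b) = 0" using n unfolding mult_eq_0_iff by linarith
  then have db: "b * (n - 1) = - d" by (simp add: algebra_simps)
  \<comment> \<open>For \<open>n = 1\<close> there are no off-diagonal entries, so \<open>b\<close>
    is arbitrary and its sign unknown; but then \<open>d = 0\<close>, and the trace forces
    \<open>w = 0\<close>.\<close>
  have "n * d \<le> n * (d - b) \<or> w = 0"
  proof (cases "n = 1")
    case True
    then have "d = 0" using db by simp
    then show ?thesis using trace card_pos by auto
  next
    case False
    have "0 \<le> n * d" unfolding trace by simp
    then have "b * (n - 1) \<le> 0" using db n by (simp add: zero_le_mult_iff)
    then have "b \<le> 0" using n False by (simp add: mult_le_0_iff)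
    then show ?thesis using n by simp
  qed
  then show ?thesis
  proof
    assume "n * d \<le> n * (d - b)"
    then have "n * d * (norm u)\<^sup>2 \<le> n * (d - b) * (norm u)\<^sup>2"
      by (rule mult_right_mono) simp
    then show ?thesis
      unfolding form u trace[symmetric] n_def[symmetric] by (simp add: mult.assoc)
  next
    assume "w = 0"
    then show ?thesis by (simp add: sum_nonneg)
  qed
qed

section \<open>From the mean square to a ball inside the orbit polytope\<close>

text \<open>The sum is fixed by \<open>\<Gamma>\<close>, so transitivity makes its coordinates
  equal, while they add up to 0.\<close>

lemma sum_permute_eq_0:
  assumes "(\<Sum>k\<in>UNIV. w $ k) = 0"
  shows "(\<Sum>\<gamma>\<in>\<Gamma>. permute_coords \<gamma> w) = 0"
proof -
  define s where "s k = (\<Sum>\<gamma>\<in>\<Gamma>. permute_coords \<gamma> w $ k)" for k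
  have inv: "s (\<delta> k) = s k" if "\<delta> \<in> \<Gamma>" for \<delta> k
    unfolding s_def
    by (subst sum_reindex_comp[OF that, symmetric]) (simp add: permute_comp_nth[OF that])
  have const: "s k = s l" for k l
    using transitive[of k l] inv by metis
  have "(\<Sum>l\<in>UNIV. s l) = (\<Sum>\<gamma>\<in>\<Gamma>. \<Sum>k\<in>UNIV. permute_coords \<gamma> w $ k)"
    unfolding s_def by (rule sum.swap)
  also have "\<dots> = 0"
    using sum_permute_coords[of _ "\<lambda>t. t" w] assms by simp
  finally have "(\<Sum>l\<in>UNIV. s l) = 0" .
  moreover have "(\<Sum>l\<in>UNIV. s l) = (\<Sum>l\<in>(UNIV :: 'n set). s k)" for k
    by (intro sum.cong refl const)
  ultimately have "real CARD('n) * s k = 0" for k by simp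
  then show ?thesis by (simp add: vec_eq_iff s_def)
qed

text \<open>Numbers in an interval from \<open>- A\<close> to \<open>m\<close> with mean 0 have mean
  square at most \<open>A * m\<close>. The Gram estimate bounds the same mean square below by
  \<open>A * A / n\<close>, where \<open>n\<close> is the dimension, and \<open>A\<close>
  cancels.\<close>

lemma norm_le_of_inner_le:
  assumes w: "(\<Sum>k\<in>UNIV. w $ k) = 0" and u: "(\<Sum>k\<in>UNIV. u $ k) = 0"
    and m: "\<And>\<gamma>. \<gamma> \<in> \<Gamma> \<Longrightarrow> permute_coords \<gamma> w \<bullet> u \<le> m"
  shows "norm w * norm u \<le> real CARD('n) * m"
proof -
  define A where "A = norm w * norm u"
  define t where "t \<gamma> = permute_coords \<gamma> w \<bullet> u" for \<gamma>
  have sum0: "sum t \<Gamma> = 0"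
    unfolding t_def by (simp add: inner_sum_left[symmetric] sum_permute_eq_0[OF w])
  have lower: "- A \<le> t \<gamma>" if "\<gamma> \<in> \<Gamma>" for \<gamma>
    using Cauchy_Schwarz_ineq2[of "permute_coords \<gamma> w" u] norm_permute_coords[OF that]
    by (simp add: t_def A_def abs_le_iff)
  have "(t \<gamma>)\<^sup>2 \<le> (m - A) * t \<gamma> + A * m" if "\<gamma> \<in> \<Gamma>" for \<gamma>
  proof -
    have "(t \<gamma> + A) * (m - t \<gamma>) \<ge> 0"
      using lower[OF that] m[OF that] by (intro mult_nonneg_nonneg) (auto simp: t_def)
    then show ?thesis by (simp add: algebra_simps power2_eq_square)
  qed
  then have "(\<Sum>\<gamma>\<in>\<Gamma>. (t \<gamma>)\<^sup>2) \<le> (\<Sum>\<gamma>\<in>\<Gamma>. (m - A) * t \<gamma> + A * m)"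
    by (rule sum_mono)
  also have "\<dots> = real (card \<Gamma>) * (A * m)"
    by (simp add: sum.distrib sum_distrib_left[symmetric] sum0)
  finally have "real CARD('n) * (\<Sum>\<gamma>\<in>\<Gamma>. (t \<gamma>)\<^sup>2) \<le> real CARD('n) * (real (card \<Gamma>) * (A * m))"
    by (rule mult_left_mono) simp
  then have "real (card \<Gamma>) * A\<^sup>2 \<le> real CARD('n) * (real (card \<Gamma>) * (A * m))"
    using sum_inner_squared[OF w u] unfolding t_def A_def power_mult_distrib by linarith
  then have "real (card \<Gamma>) * (A * A) \<le> real (card \<Gamma>) * (A * (real CARD('n) * m))"
    by (simp add: power2_eq_square mult_ac)
  then have AA: "A * A \<le> A * (real CARD('n) * m)"
    using card_pos by simp
  show ?thesis
  \<comment> \<open>Without cancellation, \<open>m \<ge> 0\<close> still follows, since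
    \<open>m\<close> bounds numbers of mean 0.\<close>
  proof (cases "A = 0")
    case True
    have "0 \<le> real (card \<Gamma>) * m"
      using sum_mono[of \<Gamma> t "\<lambda>_. m"] m sum0 by (simp add: t_def)
    then have "0 \<le> m" using card_pos by (auto simp: zero_le_mult_iff)
    then show ?thesis using True unfolding A_def by (metis mult_nonneg_nonneg of_nat_0_le_iff)
  next
    case False
    moreover have "A \<ge> 0" by (simp add: A_def)
    ultimately have "A > 0" by simp
    with AA have "A \<le> real CARD('n) * m" by (rule mult_left_le_imp_le)
    then show ?thesis by (simp only: A_def)
  qed
qed

text \<open>A hyperplane separating \<open>p\<close> from the polytope would give a direction
  \<open>u\<close> in which every orbit point stays strictly below \<open>p\<close>, contradicting
  the lower bound on the maximum over the orbit.\<close>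

lemma in_convex_hull_orbit:
  assumes w: "(\<Sum>k\<in>UNIV. w $ k) = 0" and p: "(\<Sum>k\<in>UNIV. p $ k) = 0"
    and small: "real CARD('n) * norm p \<le> norm w"
  shows "p \<in> convex hull ((\<lambda>\<gamma>. permute_coords \<gamma> w) ` \<Gamma>)" (is "p \<in> ?C")
proof (rule ccontr)
  assume "p \<notin> ?C"
  moreover have "closed ?C"
    by (intro compact_imp_closed compact_convex_hull finite_imp_compact) simp
  ultimately obtain a b where ab: "a \<bullet> p < b" "\<And>x. x \<in> ?C \<Longrightarrow> a \<bullet> x > b"
    using separating_hyperplane_closed_point[of ?C p] convex_convex_hull by blast
  \<comment> \<open>Removing the mean of the normal \<open>a\<close> does not affect inner products
    with vectors of coordinate sum 0. The sign is flipped to turn lower bounds on the orbit into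
    upper bounds.\<close>
  define \<mu> where "\<mu> = (\<Sum>k\<in>UNIV. a $ k) / real CARD('n)"
  define u where "u = \<mu> *\<^sub>R 1 - a"
  have u: "(\<Sum>k\<in>UNIV. u $ k) = 0"
    by (simp add: u_def \<mu>_def sum_subtractf)
  have inner_u: "x \<bullet> u = - (a \<bullet> x)" if "(\<Sum>k\<in>UNIV. x $ k) = 0" for x
  proof -
    have "x \<bullet> 1 = 0" using that by (simp add: inner_vec_def)
    then show ?thesis by (simp add: u_def inner_diff_right inner_commute)
  qed
  have "permute_coords \<gamma> w \<bullet> u \<le> - b" if "\<gamma> \<in> \<Gamma>" for \<gamma>
  proof -
    have "(\<Sum>k\<in>UNIV. permute_coords \<gamma> w $ k) = 0"
      using sum_permute_coords[OF that, of "\<lambda>t. t" w] w by simp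
    moreover have "permute_coords \<gamma> w \<in> ?C"
      using that by (intro hull_inc) auto
    ultimately show ?thesis using inner_u ab(2) by force
  qed
  then have "norm w * norm u \<le> real CARD('n) * (- b)"
    by (rule norm_le_of_inner_le[OF w u])
  also have "\<dots> < real CARD('n) * (p \<bullet> u)"
    using ab(1) inner_u[OF p] by (intro mult_strict_left_mono) auto
  also have "\<dots> \<le> real CARD('n) * (norm p * norm u)"
    by (intro mult_left_mono norm_cauchy_schwarz) simp
  also have "\<dots> \<le> norm w * norm u"
    using mult_right_mono[OF small, of "norm u"] by (simp add: mult.assoc)
  finally show False by simp
qed

lemma permute_coords_add_ones:
  "permute_coords \<gamma> (x + c *\<^sub>R 1) = permute_coords \<gamma> x + c *\<^sub>R 1"
  by (simp add: permute_coords_def vec_eq_iff)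

end

section \<open>Integer points near the diagonal\<close>

text \<open>Distribute the sum \<open>s\<close> as evenly as possible: \<open>s div ?n\<close>
  everywhere and one more on \<open>s mod ?n\<close> coordinates. Each coordinate is then within 1
  of the mean, and the norm is at most the sum of these deviations.\<close>

lemma exists_balanced_int_point:
  fixes z :: "real ^ 'n::finite"
  assumes "z \<in> int_points"
  defines "c \<equiv> (\<Sum>k\<in>UNIV. z $ k) / real CARD('n)"
  obtains p :: "real ^ 'n" where "p \<in> int_points" "(\<Sum>k\<in>UNIV. p $ k) = (\<Sum>k\<in>UNIV. z $ k)"
    "norm (p - c *\<^sub>R 1) \<le> real CARD('n)"
proof -
  let ?n = "int CARD('n)"
  have "(\<Sum>k\<in>UNIV. z $ k) \<in> \<int>"
    using assms(1) by (intro Ints_sum) (simp add: int_points_def)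
  then obtain s where s: "(\<Sum>k\<in>UNIV. z $ k) = of_int s"
    by (auto elim: Ints_cases)
  have r: "0 \<le> s mod ?n" "s mod ?n < ?n" by simp_all
  then have "nat (s mod ?n) \<le> card (UNIV :: 'n set)" by linarith
  then obtain A :: "'n set" where A: "card A = nat (s mod ?n)"
    using obtain_subset_with_card_n by metis
  define p :: "real ^ 'n"
    where "p = (\<chi> k. of_int (s div ?n) + (if k \<in> A then 1 else 0))"
  have cn: "c = of_int (s div ?n) + of_int (s mod ?n) / real CARD('n)"
  proof -
    have "real_of_int s = of_int (s div ?n * ?n + s mod ?n)" by simp
    also have "\<dots> = of_int (s div ?n) * real CARD('n) + of_int (s mod ?n)"
      by (simp only: of_int_add of_int_mult of_int_of_nat_eq)
    finally show ?thesis by (simp add: c_def s field_simps)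
  qed
  have "(\<Sum>k\<in>UNIV. p $ k) = real CARD('n) * of_int (s div ?n) + of_int (s mod ?n)"
    using r(1) by (simp add: p_def sum.distrib sum.If_cases A)
  also have "\<dots> = of_int s"
    using cn by (simp add: c_def s field_simps)
  finally have 1: "(\<Sum>k\<in>UNIV. p $ k) = (\<Sum>k\<in>UNIV. z $ k)" by (simp add: s)
  have "real_of_int (s mod ?n) \<le> real CARD('n)" using r(2) by linarith
  then have "0 \<le> of_int (s mod ?n) / real CARD('n)" "of_int (s mod ?n) / real CARD('n) \<le> 1"
    by simp_all
  then have "\<bar>(p - c *\<^sub>R 1) $ k\<bar> \<le> 1" for k
    by (auto simp: p_def cn)
  then have "norm (p - c *\<^sub>R 1) \<le> (\<Sum>k\<in>(UNIV :: 'n set). 1)"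
    by (intro order_trans[OF norm_le_l1_cart] sum_mono)
  then have 2: "norm (p - c *\<^sub>R 1) \<le> real CARD('n)" by simp
  have "p \<in> int_points" by (simp add: int_points_def p_def)
  then show ?thesis using 1 2 by (rule that)
qed

lemma finite_vec_nth_in:
  assumes "finite F"
  shows "finite {x :: 'a ^ 'n::finite. \<forall>i. x $ i \<in> F}"
proof (rule finite_subset)
  show "{x :: 'a ^ 'n. \<forall>i. x $ i \<in> F} \<subseteq> vec_lambda ` (UNIV \<rightarrow>\<^sub>E F)"
    by (auto intro!: image_eqI[of x vec_lambda "vec_nth x" for x])
  show "finite (vec_lambda ` (UNIV \<rightarrow>\<^sub>E F) :: ('a ^ 'n) set)"
    using assms by (intro finite_imageI finite_PiE) auto
qed

section \<open>Bounded core points and finiteness of the quotient\<close>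

text \<open>One factor is the distance allowed for the balanced point, the other comes from the
  radius of the inscribed ball. Beyond this bound the balanced point lies in the orbit
  polytope.\<close>

lemma (in transitive_two_homogeneous) core_point_norm_le:
  assumes "core_point \<Gamma> z"
  defines "c \<equiv> (\<Sum>k\<in>UNIV. z $ k) / real CARD('n)"
  shows "norm (z - c *\<^sub>R 1) \<le> real CARD('n) * real CARD('n)"
proof (rule ccontr)
  assume "\<not> ?thesis"
  then have large: "norm (z - c *\<^sub>R 1) > real CARD('n) * real CARD('n)" by simp
  have orbit: "orbit (perm_group \<Gamma>) permute_coords z = (\<lambda>\<gamma>. permute_coords \<gamma> z) ` \<Gamma>"
    by (auto simp: orbit_def)
  have z: "z \<in> int_points"
    and core: "convex hull ((\<lambda>\<gamma>. permute_coords \<gamma> z) ` \<Gamma>) \<inter> int_points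
      = (\<lambda>\<gamma>. permute_coords \<gamma> z) ` \<Gamma>"
    using assms(1) unfolding core_point_def orbit by auto
  obtain p :: "real ^ 'n" where p: "p \<in> int_points" "(\<Sum>k\<in>UNIV. p $ k) = (\<Sum>k\<in>UNIV. z $ k)"
    "norm (p - c *\<^sub>R 1) \<le> real CARD('n)"
    using exists_balanced_int_point[OF z] unfolding c_def by blast
  have "real CARD('n) * norm (p - c *\<^sub>R 1) \<le> real CARD('n) * real CARD('n)"
    using p(3) by (rule mult_left_mono) simp
  then have "real CARD('n) * norm (p - c *\<^sub>R 1) \<le> norm (z - c *\<^sub>R 1)"
    using large by linarith
  then have "p - c *\<^sub>R 1 \<in> convex hull ((\<lambda>\<gamma>. permute_coords \<gamma> (z - c *\<^sub>R 1)) ` \<Gamma>)"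
    using p(2) by (intro in_convex_hull_orbit) (simp_all add: sum_subtractf c_def)
  then have "c *\<^sub>R 1 + (p - c *\<^sub>R 1)
      \<in> convex hull ((+) (c *\<^sub>R 1) ` (\<lambda>\<gamma>. permute_coords \<gamma> (z - c *\<^sub>R 1)) ` \<Gamma>)"
    unfolding convex_hull_translation by (rule imageI)
  moreover have "permute_coords \<gamma> z = c *\<^sub>R 1 + permute_coords \<gamma> (z - c *\<^sub>R 1)" for \<gamma>
    using permute_coords_add_ones[of \<gamma> "z - c *\<^sub>R 1" c] by (simp add: add.commute)
  ultimately have "p \<in> convex hull ((\<lambda>\<gamma>. permute_coords \<gamma> z) ` \<Gamma>)"
    by (simp add: image_image)
  \<comment> \<open>The core property makes \<open>p\<close> an orbit point, yet all orbit points
    are as far from the centre as \<open>z\<close>, hence farther than \<open>p\<close>.\<close>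
  then obtain \<gamma> where \<gamma>: "\<gamma> \<in> \<Gamma>" "p = permute_coords \<gamma> z"
    using core p(1) by blast
  then have "p - c *\<^sub>R 1 = permute_coords \<gamma> (z - c *\<^sub>R 1)"
    using permute_coords_add_ones[of \<gamma> "z - c *\<^sub>R 1" c] by simp
  then have "norm (z - c *\<^sub>R 1) \<le> real CARD('n)"
    using norm_permute_coords[OF \<gamma>(1)] p(3) by simp
  also have "\<dots> \<le> real CARD('n) * real CARD('n)"
    by (simp add: Suc_leI)
  finally show False using large by simp
qed

theorem (in transitive_two_homogeneous) finite_core_points_mod_translation:
  "finite (core_points \<Gamma> // translation_rel \<Gamma>)"
proof -
  \<comment> \<open>Subtracting the floor of the mean, not the mean itself, keeps \<open>f z\<close>
    integral and in the class of \<open>z\<close> modulo the all-ones vector.\<close>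
  define q :: "real ^ 'n \<Rightarrow> int" where "q z = \<lfloor>(\<Sum>k\<in>UNIV. z $ k) / real CARD('n)\<rfloor>" for z
  define f where "f z = z - of_int (q z) *\<^sub>R 1" for z :: "real ^ 'n"
  \<comment> \<open>The extra 1 covers the fractional part of the mean, which remains in
    \<open>f z\<close>.\<close>
  define B where "B = real CARD('n) * real CARD('n) + 1"
  have "f z \<in> {x. \<forall>i. x $ i \<in> {x \<in> \<int>. - B \<le> x \<and> x \<le> B}}" if "z \<in> core_points \<Gamma>" for z
  proof -
    define c where "c = (\<Sum>k\<in>UNIV. z $ k) / real CARD('n)"
    have core: "core_point \<Gamma> z" using that by (simp add: core_points_def)
    have "f z $ i \<in> \<int> \<and> - B \<le> f z $ i \<and> f z $ i \<le> B" for i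
    proof -
      have "\<bar>(z - c *\<^sub>R 1) $ i\<bar> \<le> B - 1"
        using core_point_norm_le[OF core] component_le_norm_cart[of "z - c *\<^sub>R 1" i]
        by (simp add: c_def B_def)
      moreover have "of_int (q z) \<le> c" "c < of_int (q z) + 1"
        unfolding q_def c_def by linarith+
      moreover have "z $ i \<in> \<int>" using core by (simp add: core_point_def int_points_def)
      ultimately show ?thesis by (auto simp: f_def abs_le_iff)
    qed
    then show ?thesis by simp
  qed
  then have "f ` core_points \<Gamma> \<subseteq> {x. \<forall>i. x $ i \<in> {x \<in> \<int>. - B \<le> x \<and> x \<le> B}}"
    by blast
  then have fin: "finite (f ` core_points \<Gamma>)"
    by (rule finite_subset) (intro finite_vec_nth_in finite_int_segment)
  have class_eq: "translation_rel \<Gamma> `` {z} = translation_rel \<Gamma> `` {z'}"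
    if "z \<in> core_points \<Gamma>" "z' \<in> core_points \<Gamma>" "f z = f z'" for z z'
  proof -
    have "z - z' = of_int (q z - q z') *\<^sub>R 1"
      using that(3) by (simp add: f_def scaleR_diff_left algebra_simps)
    then have "(z, z') \<in> translation_rel \<Gamma>"
      using that(1,2) unfolding translation_rel_def by blast
    then show ?thesis by (rule equiv_class_eq[OF equiv_translation_rel])
  qed
  \<comment> \<open>The class of \<open>z\<close> depends only on \<open>f z\<close>, so it can be
    read off from any chosen preimage; the quotient is covered by the image of a finite set.\<close>
  let ?g = "\<lambda>y. translation_rel \<Gamma> `` {inv_into (core_points \<Gamma>) f y}"
  have "translation_rel \<Gamma> `` {z} = ?g (f z)" if "z \<in> core_points \<Gamma>" for z
    using that by (intro class_eq) (auto intro: inv_into_into simp: f_inv_into_f)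
  then have "core_points \<Gamma> // translation_rel \<Gamma> \<subseteq> ?g ` f ` core_points \<Gamma>"
    by (auto simp: quotient_def)
  then show ?thesis using fin by (meson finite_imageI finite_subset)
qed

theorem corollary10:
  fixes \<Gamma> :: "('n::finite \<Rightarrow> 'n) set"
  assumes "subgroup \<Gamma> (BijGroup UNIV)"
    and "transitive_action (perm_group \<Gamma>) UNIV (\<lambda>\<gamma>. \<gamma>)"
    and "two_homogeneous \<Gamma>"
  shows "finite (core_points \<Gamma> // translation_rel \<Gamma>)"
proof -
  have Bij: "\<Gamma> \<subseteq> Bij UNIV"
    using subgroup.subset[OF assms(1)] by (simp add: BijGroup_def)
  have "transitive_two_homogeneous \<Gamma>"
  proof
    show "\<Gamma> \<noteq> {}" using subgroup.one_closed[OF assms(1)] by blast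
    show "bij \<gamma>" if "\<gamma> \<in> \<Gamma>" for \<gamma>
      using Bij that by (auto simp: Bij_def)
    show "\<gamma> \<circ> \<delta> \<in> \<Gamma>" if "\<gamma> \<in> \<Gamma>" "\<delta> \<in> \<Gamma>" for \<gamma> \<delta>
    proof -
      have "\<gamma> \<in> Bij UNIV" "\<delta> \<in> Bij UNIV" using Bij that by auto
      \<comment> \<open>The group product is composition restricted to \<open>UNIV\<close>, which is
        plain composition.\<close>
      then have "\<gamma> \<otimes>\<^bsub>BijGroup UNIV\<^esub> \<delta> = \<gamma> \<circ> \<delta>"
        by (simp add: BijGroup_def compose_def fun_eq_iff)
      then show ?thesis using subgroup.m_closed[OF assms(1) that] by simp
    qed
    show "\<exists>\<gamma>\<in>\<Gamma>. \<gamma> i = j" for i j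
      using transitive_action.unique_orbit[OF assms(2), of i j] by simp
  qed (fact assms(3))
  then show ?thesis
    by (rule transitive_two_homogeneous.finite_core_points_mod_translation)
qed

end
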